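(* Let $G=\langle f_1,f_2,\ldots,f_n\rangle$ be a finitely generated nearly abelian transcendental semigroup such that every $\phi\in\Phi(G)$ has the form $\phi(z)=az+b$ with $a,b\in\mathbb{C}$ and $|a|=1$. If, for each $1\le i\le n$, all stable domains of $F(f_i)$ are bounded, then $F(G)$ does not contain any asymptotic values of $G$ (that is, no asymptotic value of any $g\in G$ lies in $F(G)$).
   Context: A transcendental semigroup $G=\langle f_1,f_2,\ldots\rangle$ is the semigroup, under composition, generated by a family of transcendental entire functions. The Fatou set $F(G)$ is the largest open subset of $\mathbb{C}$ on which the family of functions in $G$ is normal (every sequence has a subsequence converging locally uniformly to a holomorphic function or to $\infty$). For a single entire function $f$, $F(f)$ is the largest open subset of $\mathbb{C}$ on which the iterates $\{f^n\}_{n\ge1}$ form a normal family; a stable domain of $F(f)$ is a connected component of $F(f)$. A transcendental semigroup $G$ is nearly abelian if there is a precompact family $\Phi$ of affine maps $z\mapsto az+b$ ($a\neq 0$), precompact in the space of affine maps with locally uniform convergence, such that (1) $\phi(F(G))=F(G)$ for every $\phi\in\Phi$; and (2) for every $f,g\in G$ there exists $\phi\in\Phi$ with $f\circ g=\phi\circ g\circ f$. The commutator set is $\Phi(G)=\{\phi \text{ affine}: \text{there are } f,g\in G \text{ such that } f\circ g=\phi\circ g\circ f\}$. A point $w\in\mathbb{C}$ is an asymptotic value of an entire function $g$ if there is a curve $\gamma:[0,\infty)\to\mathbb{C}$ with $\gamma(t)\to\infty$ and $g(\gamma(t))\to w$ as $t\to\infty$. *)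

theory Defs
  imports "HOL-Complex_Analysis.Complex_Analysis"
begin

definition transcendental_entire :: "(complex \<Rightarrow> complex) \<Rightarrow> bool" where
  "transcendental_entire f \<longleftrightarrow>
     f holomorphic_on UNIV \<and> \<not> (\<exists>p :: complex poly. \<forall>z. f z = poly p z)"

inductive_set generated_semigroup :: "('a \<Rightarrow> 'a) set \<Rightarrow> ('a \<Rightarrow> 'a) set"
  for A :: "('a \<Rightarrow> 'a) set"
where
  generator: "f \<in> A \<Longrightarrow> f \<in> generated_semigroup A"
| compose: "f \<in> generated_semigroup A \<Longrightarrow> g \<in> generated_semigroup A \<Longrightarrow>
    f \<circ> g \<in> generated_semigroup A"

text \<open>On an open set, locally uniform convergence is uniform convergence on compact subsets.\<close>

definition locally_uniformly_converges ::
    "complex set \<Rightarrow> (nat \<Rightarrow> complex \<Rightarrow> complex) \<Rightarrow> (complex \<Rightarrow> complex) \<Rightarrow> bool" where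
  "locally_uniformly_converges U s l \<longleftrightarrow>
     (\<forall>K. compact K \<and> K \<subseteq> U \<longrightarrow> uniform_limit K s l sequentially)"

definition locally_uniformly_diverges ::
    "complex set \<Rightarrow> (nat \<Rightarrow> complex \<Rightarrow> complex) \<Rightarrow> bool" where
  "locally_uniformly_diverges U s \<longleftrightarrow>
     (\<forall>K. compact K \<and> K \<subseteq> U \<longrightarrow>
       (\<forall>B. eventually (\<lambda>k. \<forall>z\<in>K. B < cmod (s k z)) sequentially))"

definition normal_family_on :: "complex set \<Rightarrow> (complex \<Rightarrow> complex) set \<Rightarrow> bool" where
  "normal_family_on U \<F> \<longleftrightarrow>
     (\<forall>s :: nat \<Rightarrow> complex \<Rightarrow> complex. range s \<subseteq> \<F> \<longrightarrow>
       (\<exists>r :: nat \<Rightarrow> nat. strict_mono r \<and>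
         ((\<exists>l. l holomorphic_on U \<and> locally_uniformly_converges U (s \<circ> r) l) \<or>
          locally_uniformly_diverges U (s \<circ> r))))"

text \<open>
  Normality is a local property: on a disconnected open set a limit may be holomorphic on one
  component and infinite on another.  The largest open set of normality is therefore the
  union of all open sets (equivalently, all discs) on which the family is normal.
\<close>

definition Fatou_set :: "(complex \<Rightarrow> complex) set \<Rightarrow> complex set" where
  "Fatou_set \<F> = \<Union> {U. open U \<and> normal_family_on U \<F>}"

definition iterates :: "('a \<Rightarrow> 'a) \<Rightarrow> ('a \<Rightarrow> 'a) set" where
  "iterates f = {f ^^ k | k. 1 \<le> k}"

definition stable_domains :: "(complex \<Rightarrow> complex) \<Rightarrow> complex set set" where
  "stable_domains f = components (Fatou_set (iterates f))"

definition affine_maps :: "(complex \<Rightarrow> complex) set" where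
  "affine_maps = {\<phi>. \<exists>a b. a \<noteq> 0 \<and> \<phi> = (\<lambda>z. a * z + b)}"

text \<open>
  The topology of locally uniform convergence on the nonconstant affine maps.  Precompactness
  is taken inside this space, so a limit of maps of the family again has nonzero slope.
\<close>

definition open_affine_set :: "(complex \<Rightarrow> complex) set \<Rightarrow> bool" where
  "open_affine_set W \<longleftrightarrow> W \<subseteq> affine_maps \<and>
     (\<forall>\<phi>\<in>W. \<exists>K e. compact K \<and> 0 < e \<and>
       (\<forall>\<psi>\<in>affine_maps. (\<forall>z\<in>K. dist (\<psi> z) (\<phi> z) < e) \<longrightarrow> \<psi> \<in> W))"

definition affine_topology :: "(complex \<Rightarrow> complex) topology" where
  "affine_topology = topology open_affine_set"

lemma istopology_open_affine_set: "istopology open_affine_set"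
  unfolding istopology_def
proof (intro conjI allI impI)
  fix S T assume S: "open_affine_set S" and T: "open_affine_set T"
  show "open_affine_set (S \<inter> T)"
    unfolding open_affine_set_def
  proof (intro conjI ballI)
    show "S \<inter> T \<subseteq> affine_maps"
      using S by (auto simp: open_affine_set_def)
    fix \<phi> assume "\<phi> \<in> S \<inter> T"
    then obtain K e L d where
      "compact K" "0 < e" and K: "\<forall>\<psi>\<in>affine_maps. (\<forall>z\<in>K. dist (\<psi> z) (\<phi> z) < e) \<longrightarrow> \<psi> \<in> S" and
      "compact L" "0 < d" and L: "\<forall>\<psi>\<in>affine_maps. (\<forall>z\<in>L. dist (\<psi> z) (\<phi> z) < d) \<longrightarrow> \<psi> \<in> T"
      using S T unfolding open_affine_set_def by (metis IntE)
    then have "compact (K \<union> L)" "0 < min e d"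
      by auto
    moreover have "\<forall>\<psi>\<in>affine_maps.
        (\<forall>z\<in>K \<union> L. dist (\<psi> z) (\<phi> z) < min e d) \<longrightarrow> \<psi> \<in> S \<inter> T"
      using K L by simp
    ultimately show "\<exists>K e. compact K \<and> 0 < e \<and>
        (\<forall>\<psi>\<in>affine_maps. (\<forall>z\<in>K. dist (\<psi> z) (\<phi> z) < e) \<longrightarrow> \<psi> \<in> S \<inter> T)"
      by blast
  qed
next
  fix \<K> assume "\<forall>W\<in>\<K>. open_affine_set W"
  then show "open_affine_set (\<Union>\<K>)"
    unfolding open_affine_set_def by (meson Sup_least UnionE UnionI)
qed

lemma openin_affine_topology: "openin affine_topology = open_affine_set"
  unfolding affine_topology_def by (rule topology_inverse'[OF istopology_open_affine_set])

lemma topspace_affine_topology: "topspace affine_topology = affine_maps"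
proof
  show "topspace affine_topology \<subseteq> affine_maps"
    unfolding topspace_def openin_affine_topology open_affine_set_def by blast
  have "openin affine_topology affine_maps"
    unfolding openin_affine_topology open_affine_set_def
    using compact_empty zero_less_one by blast
  then show "affine_maps \<subseteq> topspace affine_topology"
    by (rule openin_subset)
qed

definition precompact_affine :: "(complex \<Rightarrow> complex) set \<Rightarrow> bool" where
  "precompact_affine \<Phi> \<longleftrightarrow>
     \<Phi> \<subseteq> affine_maps \<and> compactin affine_topology (affine_topology closure_of \<Phi>)"

definition nearly_abelian :: "(complex \<Rightarrow> complex) set \<Rightarrow> bool" where
  "nearly_abelian G \<longleftrightarrow>
     (\<exists>\<Phi>. precompact_affine \<Phi> \<and>
       (\<forall>\<phi>\<in>\<Phi>. \<phi> ` Fatou_set G = Fatou_set G) \<and>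
       (\<forall>f\<in>G. \<forall>g\<in>G. \<exists>\<phi>\<in>\<Phi>. f \<circ> g = \<phi> \<circ> g \<circ> f))"

definition commutator_set :: "(complex \<Rightarrow> complex) set \<Rightarrow> (complex \<Rightarrow> complex) set" where
  "commutator_set G = {\<phi> \<in> affine_maps. \<exists>f\<in>G. \<exists>g\<in>G. f \<circ> g = \<phi> \<circ> g \<circ> f}"

definition asymptotic_value :: "(complex \<Rightarrow> complex) \<Rightarrow> complex \<Rightarrow> bool" where
  "asymptotic_value g w \<longleftrightarrow>
     (\<exists>\<gamma> :: real \<Rightarrow> complex. continuous_on {0..} \<gamma> \<and>
       filterlim \<gamma> at_infinity at_top \<and> ((\<lambda>t. g (\<gamma> t)) \<longlongrightarrow> w) at_top)"

end

theory Submission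
  imports Defs
begin

text \<open>
  The point is that \<open>g -` F(G) \<subseteq> F(G)\<close> for every \<open>g \<in> G\<close>.  Near a point that \<open>g\<close> sends into
  \<open>F(G)\<close>, a sequence of maps \<open>h \<circ> g\<close> with \<open>h \<in> G\<close> is, after extraction, locally bounded or
  divergent; as \<open>g \<circ> h\<close> differs from \<open>h \<circ> g\<close> by an isometry from a precompact family, the same
  holds for \<open>g \<circ> h\<close>.  If \<open>g \<circ> h \<rightarrow> \<infinity>\<close> then \<open>h \<rightarrow> \<infinity>\<close>; and if \<open>g \<circ> h\<close> is bounded by \<open>M\<close>, then
  the maps \<open>h\<close> omit the nonempty open set \<open>{z. \<bar>g z\<bar> > M}\<close>, so Montel's theorem for bounded
  families applies to \<open>1 / (h - c)\<close>.  If now \<open>g(\<gamma>(t)) \<rightarrow> w \<in> F(G)\<close> along a curve tending to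
  infinity, a tail of the curve lies in \<open>F(G) \<subseteq> F(f\<^sub>1)\<close>, hence in one unbounded stable domain.
\<close>

section \<open>Normality of families omitting a disc\<close>

text \<open>The maps \<open>1 / (h - c)\<close> are bounded by \<open>1 / d\<close>, so Montel
  yields a limit \<open>l\<close>. By Hurwitz on the connected set \<open>U\<close>, either
  \<open>l\<close> vanishes identically and the original maps diverge, or \<open>l\<close> has no
  zeros and they converge to \<open>c + 1 / l\<close>.\<close>

lemma normal_family_on_omitting_ball:
  assumes U: "open U" "connected U"
    and hol: "\<And>h. h \<in> \<F> \<Longrightarrow> h holomorphic_on U"
    and d: "0 < d" "\<And>h z. h \<in> \<F> \<Longrightarrow> z \<in> U \<Longrightarrow> d \<le> cmod (h z - c)"
  shows "normal_family_on U \<F>"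
  unfolding normal_family_on_def
proof (intro allI impI)
  fix s :: "nat \<Rightarrow> complex \<Rightarrow> complex"
  assume s: "range s \<subseteq> \<F>"
  have sF: "s k \<in> \<F>" for k using s by auto
  define F where "F k z = inverse (s k z - c)" for k z
  have nz: "s k z - c \<noteq> 0" if "z \<in> U" for k z
    using d(2)[OF sF that, of k] d(1) by auto
  have holF: "F k holomorphic_on U" for k
    unfolding F_def using hol[OF sF] nz by (intro holomorphic_intros) auto
  have bdF: "cmod (F k z) \<le> inverse d" if "z \<in> U" for k z
    unfolding F_def norm_inverse using d(2)[OF sF that] d(1) by (intro le_imp_inverse_le) auto
  obtain l r where l: "l holomorphic_on U" and r: "strict_mono r"
    and lim: "\<And>K. compact K \<Longrightarrow> K \<subseteq> U \<Longrightarrow> uniform_limit K (F \<circ> r) l sequentially"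
  proof (rule Montel[OF U(1), of "range F" F])
    show "\<And>h. h \<in> range F \<Longrightarrow> h holomorphic_on U" using holF by auto
    show "\<And>K. compact K \<Longrightarrow> K \<subseteq> U \<Longrightarrow> \<exists>B. \<forall>h\<in>range F. \<forall>z\<in>K. cmod (h z) \<le> B"
      using bdF by blast
  qed auto
  show "\<exists>r. strict_mono r \<and>
      ((\<exists>l. l holomorphic_on U \<and> locally_uniformly_converges U (s \<circ> r) l) \<or>
       locally_uniformly_diverges U (s \<circ> r))"
  proof (cases "\<forall>z\<in>U. l z = 0")
    case True
    have "\<forall>\<^sub>F k in sequentially. \<forall>z\<in>K. B < cmod ((s \<circ> r) k z)"
      if K: "compact K" "K \<subseteq> U" for K B
    proof -
      \<comment> \<open>If the inverse of \<open>s - c\<close> is below \<open>e\<close>, then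
        \<open>s - c\<close> has modulus above \<open>\<bar>B\<bar> + cmod c + 1\<close>, which
        leaves more than \<open>B\<close> after removing \<open>c\<close>. The absolute value keeps
        \<open>e\<close> positive for negative \<open>B\<close>.\<close>
      define e where "e = inverse (\<bar>B\<bar> + cmod c + 1)"
      have e: "0 < e" unfolding e_def by (simp add: add_nonneg_pos)
      have "\<forall>\<^sub>F k in sequentially. \<forall>z\<in>K. dist ((F \<circ> r) k z) (l z) < e"
        using lim[OF K] e by (auto simp: uniform_limit_iff)
      then show ?thesis
      proof (rule eventually_mono, intro ballI)
        fix k z assume *: "\<forall>z\<in>K. dist ((F \<circ> r) k z) (l z) < e" and z: "z \<in> K"
        have "inverse (cmod (s (r k) z - c)) < inverse (\<bar>B\<bar> + cmod c + 1)"
          using *[rule_format, OF z] True z K(2)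
          by (auto simp: F_def norm_inverse e_def dist_norm)
        then have "\<bar>B\<bar> + cmod c + 1 < cmod (s (r k) z - c)"
          by (rule inverse_less_imp_less) (use nz z K(2) in auto)
        then show "B < cmod ((s \<circ> r) k z)"
          using norm_triangle_ineq4[of "s (r k) z" c] by simp
      qed
    qed
    then show ?thesis using r by (auto simp: locally_uniformly_diverges_def)
  next
    case False
    have lnz: "l z \<noteq> 0" if z: "z \<in> U" for z
    \<comment> \<open>Hurwitz needs a nonconstant limit; a constant that is nonzero somewhere is
      nonzero everywhere.\<close>
    proof (cases "l constant_on U")
      case True
      then show ?thesis using False z by (auto simp: constant_on_def)
    next
      case const: False
      show ?thesis
      proof (rule Hurwitz_no_zeros[OF U, of "F \<circ> r" l])
        show "(F \<circ> r) k z \<noteq> 0" if "z \<in> U" for k z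
          using nz[OF that] by (simp add: F_def)
      qed (use holF l lim const z in auto)
    qed
    have "uniform_limit K (s \<circ> r) (\<lambda>z. c + inverse (l z)) sequentially"
      if K: "compact K" "K \<subseteq> U" for K
    proof (cases "K = {}")
      case False
      \<comment> \<open>Inversion preserves uniform convergence once \<open>l\<close> is bounded
        away from 0; the bound is its minimum modulus on \<open>K\<close>.\<close>
      have "continuous_on K (\<lambda>z. cmod (l z))"
        using l K(2) by (intro continuous_intros holomorphic_on_imp_continuous_on)
          (rule holomorphic_on_subset)
      then obtain x where x: "x \<in> K" "\<And>z. z \<in> K \<Longrightarrow> cmod (l x) \<le> cmod (l z)"
        using continuous_attains_inf[OF K(1) False] by blast
      have "uniform_limit K (\<lambda>k z. inverse ((F \<circ> r) k z)) (inverse \<circ> l) sequentially"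
        using x lnz K(2) by (intro uniform_lim_inverse[OF lim[OF K], where b = "cmod (l x)"]) auto
      then have "uniform_limit K (\<lambda>k z. c + inverse ((F \<circ> r) k z)) (\<lambda>z. c + (inverse \<circ> l) z) sequentially"
        by (intro uniform_limit_intros)
      then show ?thesis by (simp add: F_def o_def)
    qed simp
    moreover have "(\<lambda>z. c + inverse (l z)) holomorphic_on U"
      using l lnz by (intro holomorphic_intros) auto
    ultimately show ?thesis using r by (auto simp: locally_uniformly_converges_def)
  qed
qed

section \<open>Monotonicity and backward invariance of Fatou sets\<close>

lemma normal_family_on_subset:
  "normal_family_on U \<F> \<Longrightarrow> \<G> \<subseteq> \<F> \<Longrightarrow> normal_family_on U \<G>"
  unfolding normal_family_on_def by (meson order_trans)

lemma Fatou_set_antimono: "\<G> \<subseteq> \<F> \<Longrightarrow> Fatou_set \<F> \<subseteq> Fatou_set \<G>"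
  unfolding Fatou_set_def using normal_family_on_subset by blast

lemma open_Fatou_set: "open (Fatou_set \<F>)"
  unfolding Fatou_set_def by auto

text \<open>The hypothesis \<open>comm\<close> abstracts near commutativity: an isometry
  \<open>az + b\<close> changes moduli by at most \<open>|b|\<close>, and both boundedness and
  divergence survive a bounded error.\<close>

lemma vimage_Fatou_set_subset:
  assumes hol: "\<And>h. h \<in> \<F> \<Longrightarrow> h holomorphic_on UNIV"
    and g: "g holomorphic_on UNIV" "\<not> g constant_on UNIV"
    and comm: "\<And>h z. h \<in> \<F> \<Longrightarrow> \<bar>cmod (g (h z)) - cmod (h (g z))\<bar> \<le> B"
  shows "g -` Fatou_set \<F> \<subseteq> Fatou_set \<F>"
proof
  fix z0 assume "z0 \<in> g -` Fatou_set \<F>"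
  then obtain V where V: "open V" "normal_family_on V \<F>" "g z0 \<in> V"
    by (auto simp: Fatou_set_def)
  have contg: "continuous_on A g" for A
    using holomorphic_on_imp_continuous_on[OF g(1)] continuous_on_subset by blast
  have "open (g -` V)" using V(1) contg by (rule open_vimage)
  \<comment> \<open>A closed disc is taken so that its image \<open>C\<close> is compact and
    convergence or divergence is uniform on it.\<close>
  then obtain e where e: "0 < e" "cball z0 e \<subseteq> g -` V"
    using V(3) open_contains_cball[of "g -` V"] by (meson vimageI)
  define C where "C = g ` cball z0 e"
  have C: "compact C" "C \<subseteq> V"
    unfolding C_def using e(2) contg by (auto intro: compact_continuous_image)
  have "normal_family_on (ball z0 e) \<F>"
    unfolding normal_family_on_def
  proof (intro allI impI)
    fix s :: "nat \<Rightarrow> complex \<Rightarrow> complex"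
    assume s: "range s \<subseteq> \<F>"
    have sF: "s k \<in> \<F>" for k using s by auto
    have mem: "g z \<in> C" if "z \<in> cball z0 e" for z using that by (auto simp: C_def)
    obtain r where r: "strict_mono r"
      and cases: "(\<exists>l. l holomorphic_on V \<and> locally_uniformly_converges V (s \<circ> r) l) \<or>
          locally_uniformly_diverges V (s \<circ> r)"
      using V(2) s unfolding normal_family_on_def by blast
    from cases show "\<exists>r. strict_mono r \<and>
      ((\<exists>l. l holomorphic_on ball z0 e \<and> locally_uniformly_converges (ball z0 e) (s \<circ> r) l) \<or>
       locally_uniformly_diverges (ball z0 e) (s \<circ> r))"
    proof
      assume "\<exists>l. l holomorphic_on V \<and> locally_uniformly_converges V (s \<circ> r) l"
      then obtain l where l: "l holomorphic_on V" "uniform_limit C (s \<circ> r) l sequentially"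
        using C unfolding locally_uniformly_converges_def by blast
      have "continuous_on C l"
        using l(1) C(2) holomorphic_on_imp_continuous_on holomorphic_on_subset by blast
      then have "bounded (l ` C)"
        using C(1) compact_continuous_image compact_imp_bounded by blast
      then obtain M where M: "\<And>z. z \<in> C \<Longrightarrow> cmod (l z) \<le> M"
        by (auto simp: bounded_iff)
      have "\<forall>\<^sub>F k in sequentially. \<forall>z\<in>C. dist ((s \<circ> r) k z) (l z) < 1"
        using l(2) by (auto simp: uniform_limit_iff)
      then obtain N where N: "\<And>k z. N \<le> k \<Longrightarrow> z \<in> C \<Longrightarrow> dist (s (r k) z) (l z) < 1"
        by (auto simp: eventually_sequentially)
      \<comment> \<open>The first \<open>N\<close> terms are dropped so that one bound holds for
        every member of the family, not just eventually.\<close>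
      define t where "t k = s (r (k + N))" for k
      have t_bd: "cmod (g (t k z)) \<le> M + 1 + B" if "z \<in> ball z0 e" for k z
      proof -
        have "cmod (t k (g z)) \<le> cmod (l (g z)) + dist (t k (g z)) (l (g z))"
          by (metis dist_norm norm_triangle_sub)
        then have "cmod (t k (g z)) \<le> M + 1"
          using N[of "k + N" "g z"] M[of "g z"] mem[of z] that by (force simp: t_def)
        then show ?thesis using comm[OF sF, of "r (k + N)" z] by (simp add: t_def)
      qed
      \<comment> \<open>By Liouville \<open>g\<close> exceeds the bound at some \<open>c\<close>,
        hence on a disc around \<open>c\<close>, and no value of \<open>t k\<close> can lie in that
        disc.\<close>
      have "\<not> bounded (range g)"
        using Liouville_theorem[OF g(1)] g(2) by (auto simp: constant_on_def)
      then obtain c where c: "M + 1 + B < cmod (g c)"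
        unfolding bounded_iff by (auto simp: not_le)
      have "open {z. M + 1 + B < cmod (g z)}"
        using contg by (intro open_Collect_less continuous_intros) auto
      then obtain d where d: "0 < d" "ball c d \<subseteq> {z. M + 1 + B < cmod (g z)}"
        using c open_contains_ball by (metis mem_Collect_eq)
      have "normal_family_on (ball z0 e) (range t)"
      proof (rule normal_family_on_omitting_ball[OF _ _ _ d(1)])
        fix h z assume "h \<in> range t" and z: "z \<in> ball z0 e"
        then obtain k where "h = t k" by blast
        then have "h z \<notin> ball c d" using t_bd[OF z, of k] d(2) by auto
        then show "d \<le> cmod (h z - c)" by (simp add: dist_norm norm_minus_commute)
      next
        fix h assume "h \<in> range t"
        then show "h holomorphic_on ball z0 e"
          using holomorphic_on_subset[OF hol[OF sF]] by (auto simp: t_def)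
      qed auto
      then obtain q where q: "strict_mono q"
        and tq: "(\<exists>l. l holomorphic_on ball z0 e \<and> locally_uniformly_converges (ball z0 e) (t \<circ> q) l) \<or>
          locally_uniformly_diverges (ball z0 e) (t \<circ> q)"
        unfolding normal_family_on_def by blast
      have "strict_mono (\<lambda>k. r (q k + N))"
        using r q by (simp add: strict_mono_def)
      moreover have "t \<circ> q = s \<circ> (\<lambda>k. r (q k + N))"
        by (simp add: t_def fun_eq_iff)
      ultimately show ?thesis using tq by metis
    next
      assume div: "locally_uniformly_diverges V (s \<circ> r)"
      have "\<forall>\<^sub>F k in sequentially. \<forall>z\<in>K. A < cmod ((s \<circ> r) k z)"
        if K: "K \<subseteq> ball z0 e" for K A
      proof -
        \<comment> \<open>Since \<open>g\<close> is bounded by \<open>M\<close> on the disc of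
          radius \<open>A\<close>, a value of \<open>g\<close> beyond \<open>M\<close> forces an
          argument beyond \<open>A\<close>.\<close>
        have "bounded (g ` cball 0 A)"
          using contg compact_continuous_image compact_imp_bounded compact_cball by blast
        then obtain M where M: "\<And>z. cmod z \<le> A \<Longrightarrow> cmod (g z) \<le> M"
          by (force simp: bounded_iff)
        have "\<forall>\<^sub>F k in sequentially. \<forall>z\<in>C. M + B < cmod ((s \<circ> r) k z)"
          using div C unfolding locally_uniformly_diverges_def by blast
        then show ?thesis
        proof (rule eventually_mono, intro ballI)
          fix k z assume *: "\<forall>z\<in>C. M + B < cmod ((s \<circ> r) k z)" and z: "z \<in> K"
          have "M + B < cmod (s (r k) (g z))"
            using * mem[of z] z K by auto
          then have "M < cmod (g (s (r k) z))"
            using comm[OF sF, of "r k" z] by simp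
          then show "A < cmod ((s \<circ> r) k z)"
            using M[of "s (r k) z"] by force
        qed
      qed
      then have "locally_uniformly_diverges (ball z0 e) (s \<circ> r)"
        by (simp add: locally_uniformly_diverges_def)
      then show ?thesis using r by blast
    qed
  qed
  then show "z0 \<in> Fatou_set \<F>"
    using e(1) unfolding Fatou_set_def by (metis (mono_tags, lifting) UnionI centre_in_ball mem_Collect_eq open_ball)
qed

section \<open>Elements of the generated semigroup\<close>

text \<open>The range of \<open>g\<close> is open by the open mapping theorem, so \<open>f\<close>
  constant there would be constant everywhere by the identity theorem.\<close>

lemma nonconstant_entire_compose:
  assumes "f holomorphic_on UNIV" "\<not> f constant_on UNIV"
    and "g holomorphic_on UNIV" "\<not> g constant_on UNIV"
  shows "\<not> (f \<circ> g) constant_on (UNIV :: complex set)"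
proof
  assume "(f \<circ> g) constant_on UNIV"
  then obtain c where c: "\<And>z. f (g z) = c" by (auto simp: constant_on_def)
  have "open (range g)"
    using open_mapping_thm[OF assms(3) _ _ _ _ assms(4)] by auto
  then have "f z = c" for z
    using analytic_continuation_open[of "range g" UNIV f "\<lambda>_. c" z] assms(1) c by auto
  then show False using assms(2) by (auto simp: constant_on_def)
qed

lemma generated_semigroup_nonconstant_entire:
  assumes "h \<in> generated_semigroup A"
    and "\<And>f. f \<in> A \<Longrightarrow> f holomorphic_on UNIV \<and> \<not> f constant_on (UNIV :: complex set)"
  shows "h holomorphic_on UNIV \<and> \<not> h constant_on UNIV"
  using assms(1)
proof induction
  case (generator f)
  then show ?case using assms(2) by blast
next
  case (compose f g)
  then show ?case
    using nonconstant_entire_compose holomorphic_on_compose_gen[of g UNIV f UNIV] by blast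
qed

lemma transcendental_entire_nonconstant:
  assumes "transcendental_entire f"
  shows "\<not> f constant_on UNIV"
proof
  assume "f constant_on UNIV"
  then obtain c where "\<And>z. f z = poly [:c:] z" by (auto simp: constant_on_def)
  then show False using assms unfolding transcendental_entire_def by blast
qed

lemma iterates_subset_generated_semigroup:
  assumes "f \<in> A"
  shows "iterates f \<subseteq> generated_semigroup A"
proof -
  \<comment> \<open>\<open>iterates\<close> starts at exponent 1, since the semigroup need not
    contain the identity.\<close>
  have "f ^^ Suc k \<in> generated_semigroup A" for k
  proof (induction k)
    case 0
    then show ?case using assms by (simp add: generated_semigroup.generator)
  next
    case (Suc k)
    then show ?case
      using generated_semigroup.compose[OF generated_semigroup.generator[OF assms]]
      unfolding funpow.simps(2)[of "Suc k"] by blast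
  qed
  then show ?thesis
    unfolding iterates_def by (auto dest!: Suc_le_D)
qed

section \<open>Bounded translation parts of precompact affine families\<close>

text \<open>The singleton of \<open>z\<close> is an admissible compact test set in
  \<open>open_affine_set\<close>.\<close>

lemma continuous_map_affine_eval: "continuous_map affine_topology euclidean (\<lambda>\<phi>. \<phi> z)"
proof -
  have "open_affine_set {\<phi> \<in> affine_maps. \<phi> z \<in> W}" if W: "open W" for W
    unfolding open_affine_set_def
  proof (intro conjI ballI)
    show "{\<phi> \<in> affine_maps. \<phi> z \<in> W} \<subseteq> affine_maps" by simp
    fix \<phi> assume "\<phi> \<in> {\<phi> \<in> affine_maps. \<phi> z \<in> W}"
    then have "\<phi> z \<in> W" by simp
    with W obtain e where e: "0 < e" "ball (\<phi> z) e \<subseteq> W" by (rule openE)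
    have "\<psi> z \<in> W" if "\<forall>x\<in>{z}. dist (\<psi> x) (\<phi> x) < e" for \<psi>
      using that by (intro subsetD[OF e(2)]) (simp add: dist_commute)
    then have "compact {z} \<and> 0 < e \<and> (\<forall>\<psi>\<in>affine_maps.
        (\<forall>x\<in>{z}. dist (\<psi> x) (\<phi> x) < e) \<longrightarrow> \<psi> \<in> {\<phi> \<in> affine_maps. \<phi> z \<in> W})"
      using e(1) by simp
    then show "\<exists>K e. compact K \<and> 0 < e \<and> (\<forall>\<psi>\<in>affine_maps.
        (\<forall>z\<in>K. dist (\<psi> z) (\<phi> z) < e) \<longrightarrow> \<psi> \<in> {\<phi> \<in> affine_maps. \<phi> z \<in> W})"
      by (intro exI)
  qed
  then show ?thesis
    by (simp add: continuous_map_def openin_affine_topology topspace_affine_topology)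
qed

text \<open>Evaluation maps the compact closure to a compact set. At 0 it reads off the translation
  part \<open>b\<close> of \<open>az + b\<close>.\<close>

lemma precompact_affine_bounded_eval:
  assumes "precompact_affine \<Phi>"
  shows "bounded ((\<lambda>\<phi>. \<phi> z) ` \<Phi>)"
proof -
  have "compact ((\<lambda>\<phi>. \<phi> z) ` (affine_topology closure_of \<Phi>))"
    using assms image_compactin[OF _ continuous_map_affine_eval, of "affine_topology closure_of \<Phi>" z]
    by (simp add: precompact_affine_def)
  moreover have "\<Phi> \<subseteq> affine_topology closure_of \<Phi>"
    using assms by (simp add: precompact_affine_def topspace_affine_topology closure_of_subset)
  ultimately show ?thesis
    by (meson bounded_subset compact_imp_bounded image_mono)
qed

section \<open>Curves tending to infinity and the conclusion\<close>

lemma asymptotic_curve_in_unbounded_component: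
  fixes \<gamma> :: "real \<Rightarrow> complex"
  assumes "continuous_on {0..} \<gamma>" "filterlim \<gamma> at_infinity at_top"
    and "\<forall>\<^sub>F t in at_top. \<gamma> t \<in> S"
  shows "\<exists>U \<in> components S. \<not> bounded U"
proof -
  obtain T where T: "\<And>t. T \<le> t \<Longrightarrow> \<gamma> t \<in> S"
    using assms(3) by (auto simp: eventually_at_top_linorder)
  \<comment> \<open>The maximum with 0 keeps the tail inside the half-line where \<gamma> is
    continuous.\<close>
  define L where "L = \<gamma> ` {max 0 T..}"
  have L: "connected L" "L \<subseteq> S" "L \<noteq> {}"
    unfolding L_def using T assms(1)
    by (auto intro!: connected_continuous_image connected_Ici intro: continuous_on_subset)
  then obtain U where U: "U \<in> components S" "L \<subseteq> U"
    using exists_component_superset[of L S] by blast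
  have "\<not> bounded L"
  proof
    assume "bounded L"
    then obtain M where M: "\<And>t. max 0 T \<le> t \<Longrightarrow> cmod (\<gamma> t) \<le> M"
      by (force simp: L_def bounded_iff)
    have "\<forall>\<^sub>F t in at_top. M + 1 \<le> cmod (\<gamma> t)"
      using filterlim_at_infinity_imp_norm_at_top[OF assms(2)] by (simp add: filterlim_at_top)
    then have "\<forall>\<^sub>F t in at_top. M + 1 \<le> cmod (\<gamma> t) \<and> max 0 T \<le> t"
      using eventually_ge_at_top by (rule eventually_conj)
    then obtain t where "M + 1 \<le> cmod (\<gamma> t)" "max 0 T \<le> t"
      by (auto dest: eventually_happens)
    then show False using M[of t] by simp
  qed
  then show ?thesis using U bounded_subset by blast
qed

theorem theorem9:
  fixes f :: "nat \<Rightarrow> complex \<Rightarrow> complex" and n :: nat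
    and G :: "(complex \<Rightarrow> complex) set"
  assumes "1 \<le> n"
    and "\<And>i. i \<in> {1..n} \<Longrightarrow> transcendental_entire (f i)"
    and "G = generated_semigroup (f ` {1..n})"
    and "nearly_abelian G"
    and "\<And>\<phi>. \<phi> \<in> commutator_set G \<Longrightarrow> \<exists>a b. cmod a = 1 \<and> \<phi> = (\<lambda>z. a * z + b)"
    and "\<And>i U. i \<in> {1..n} \<Longrightarrow> U \<in> stable_domains (f i) \<Longrightarrow> bounded U"
  shows "\<forall>g\<in>G. \<forall>w. asymptotic_value g w \<longrightarrow> w \<notin> Fatou_set G"
proof (intro ballI allI impI notI)
  fix g w assume g: "g \<in> G" and "asymptotic_value g w" and w: "w \<in> Fatou_set G"
  then obtain \<gamma> :: "real \<Rightarrow> complex" where \<gamma>: "continuous_on {0..} \<gamma>" "filterlim \<gamma> at_infinity at_top"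
    "((\<lambda>t. g (\<gamma> t)) \<longlongrightarrow> w) at_top"
    by (auto simp: asymptotic_value_def)
  have G: "h holomorphic_on UNIV \<and> \<not> h constant_on UNIV" if "h \<in> G" for h
    using that assms(2) transcendental_entire_nonconstant unfolding assms(3)
    by (elim generated_semigroup_nonconstant_entire) (auto simp: transcendental_entire_def)
  obtain \<Phi> where \<Phi>: "precompact_affine \<Phi>" "\<forall>h\<in>G. \<forall>k\<in>G. \<exists>\<phi>\<in>\<Phi>. h \<circ> k = \<phi> \<circ> k \<circ> h"
    using assms(4) unfolding nearly_abelian_def by (elim exE conjE)
  obtain B where B: "\<And>\<phi>. \<phi> \<in> \<Phi> \<Longrightarrow> cmod (\<phi> 0) \<le> B"
    using precompact_affine_bounded_eval[OF \<Phi>(1), of 0] by (auto simp: bounded_iff)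
  have "\<bar>cmod (g (h z)) - cmod (h (g z))\<bar> \<le> B" if h: "h \<in> G" for h z
  proof -
    obtain \<phi> where \<phi>: "\<phi> \<in> \<Phi>" "g \<circ> h = \<phi> \<circ> h \<circ> g"
      using \<Phi>(2) g h by blast
    \<comment> \<open>The family \<Phi> is only some witness of near abelianness; a member realizing
      a commutation relation lies in \<open>commutator_set G\<close>, so its slope has modulus
      1.\<close>
    then have "\<phi> \<in> commutator_set G"
      using \<Phi>(1) g h by (auto simp: commutator_set_def precompact_affine_def)
    then obtain a b where ab: "cmod a = 1" "\<phi> = (\<lambda>z. a * z + b)"
      using assms(5) by blast
    have "g (h z) = a * h (g z) + b"
      using fun_cong[OF \<phi>(2), of z] ab(2) by simp
    moreover have "cmod b \<le> B" using B[OF \<phi>(1)] ab(2) by simp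
    ultimately show ?thesis
      using norm_triangle_ineq3[of "a * h (g z) + b" "a * h (g z)"] ab(1)
      by (simp add: norm_mult)
  qed
  then have "g -` Fatou_set G \<subseteq> Fatou_set G"
    using G g by (intro vimage_Fatou_set_subset[where B = B]) auto
  \<comment> \<open>The iterates of \<open>f 1\<close> form a subfamily of \<open>G\<close>, and a
    smaller family has a larger Fatou set.\<close>
  moreover have "Fatou_set G \<subseteq> Fatou_set (iterates (f 1))"
    unfolding assms(3) using assms(1)
    by (intro Fatou_set_antimono iterates_subset_generated_semigroup) auto
  moreover have "\<forall>\<^sub>F t in at_top. g (\<gamma> t) \<in> Fatou_set G"
    using topological_tendstoD[OF \<gamma>(3) open_Fatou_set w] .
  ultimately have "\<forall>\<^sub>F t in at_top. \<gamma> t \<in> Fatou_set (iterates (f 1))"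
    by (elim eventually_mono) auto
  then obtain U where "U \<in> stable_domains (f 1)" "\<not> bounded U"
    using asymptotic_curve_in_unbounded_component[OF \<gamma>(1,2)] unfolding stable_domains_def by blast
  then show False using assms(1) assms(6)[of 1] by simp
qed

end
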